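(* Let $(P,\cdot,\circ)$ be a transposed Novikov-Poisson algebra (of arbitrary dimension) over a field $\mathbf{k}$ with $\operatorname{char}\mathbf{k}\neq 2$. Then the following statements are equivalent: (i) $P$ is right nilpotent; (ii) $P^2$ is nilpotent; (iii) $P$ is solvable.
   Context: A (left) Novikov algebra $(P,\circ)$ is a vector space with a bilinear operation satisfying $(x\circ y)\circ z=(x\circ z)\circ y$ and $(x\circ y)\circ z-x\circ(y\circ z)=(y\circ x)\circ z-y\circ(x\circ z)$ for all $x,y,z$. A transposed Novikov-Poisson algebra is a triple $(P,\cdot,\circ)$ such that $(P,\cdot)$ is a commutative associative algebra (not necessarily unital), $(P,\circ)$ is a Novikov algebra, and for all $x,y,z\in P$: $(x\cdot y)\circ z=(x\cdot z)\circ y$ and $2z\cdot(x\circ y)=(z\cdot x)\circ y+x\circ(z\cdot y)$. For subspaces $X,Y$ of $P$, $X\cdot Y$ (resp. $X\circ Y$) denotes the linear span of all $x\cdot y$ (resp. $x\circ y$), $x\in X$, $y\in Y$. A subalgebra is a linear subspace $A$ with $A\cdot A+A\circ A\subseteq A$. For a subalgebra $A$: - Derived series: $A^{(0)}=A$, $A^{(n+1)}=A^{(n)}\cdot A^{(n)}+A^{(n)}\circ A^{(n)}$; $A$ is solvable if $A^{(m)}=0$ for some $m\ge 0$. - Lower central series: $A^1=A$, $A^n=\sum_{i=1}^{n-1}(A^i\cdot A^{n-i}+A^i\circ A^{n-i})$ for $n\ge 2$; $A$ is nilpotent if $A^m=0$ for some $m\ge 1$. In particular $P^2=P\cdot P+P\circ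 P$, which is a subalgebra of $P$. - $A_L^1=A$, $A_L^n=A_L^{n-1}\cdot A+A_L^{n-1}\circ A$ for $n\ge 2$; $A$ is right nilpotent if $A_L^n=0$ for some $n\geq 1$. *)

theory Defs
  imports Complex_Main "HOL-Library.Set_Algebras"
begin

text \<open>
  An algebra lives on a whole type \<open>'v\<close>, made into a vector space over the field \<open>'k\<close> by \<open>scale\<close>;
  thus \<open>P\<close> is \<open>UNIV\<close> and subalgebras are sets. No dimension restriction is imposed.
\<close>

locale vector_space_bilinear = vector_space scale
  for scale :: "'k::field \<Rightarrow> 'v::ab_group_add \<Rightarrow> 'v" +
  fixes mult :: "'v \<Rightarrow> 'v \<Rightarrow> 'v"
  assumes linear_left: "Vector_Spaces.linear scale scale (\<lambda>x. mult x y)"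
    and linear_right: "Vector_Spaces.linear scale scale (\<lambda>y. mult x y)"

locale comm_assoc_algebra = vector_space_bilinear scale dot
  for scale :: "'k::field \<Rightarrow> 'v::ab_group_add \<Rightarrow> 'v"
    and dot :: "'v \<Rightarrow> 'v \<Rightarrow> 'v" (infixl \<open>\<cdot>\<close> 70) +
  assumes dot_assoc: "(x \<cdot> y) \<cdot> z = x \<cdot> (y \<cdot> z)"
    and dot_commute: "x \<cdot> y = y \<cdot> x"

locale novikov_algebra = vector_space_bilinear scale circ
  for scale :: "'k::field \<Rightarrow> 'v::ab_group_add \<Rightarrow> 'v"
    and circ :: "'v \<Rightarrow> 'v \<Rightarrow> 'v" (infixl \<open>\<odot>\<close> 70) +
  assumes circ_right_commute: "(x \<odot> y) \<odot> z = (x \<odot> z) \<odot> y"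
    and circ_left_symmetric:
      "(x \<odot> y) \<odot> z - x \<odot> (y \<odot> z) = (y \<odot> x) \<odot> z - y \<odot> (x \<odot> z)"

locale transposed_novikov_poisson =
  comm_assoc_algebra scale dot + novikov_algebra scale circ
  for scale :: "'k::field \<Rightarrow> 'v::ab_group_add \<Rightarrow> 'v"
    and dot :: "'v \<Rightarrow> 'v \<Rightarrow> 'v" (infixl \<open>\<cdot>\<close> 70)
    and circ :: "'v \<Rightarrow> 'v \<Rightarrow> 'v" (infixl \<open>\<odot>\<close> 70) +
  assumes dot_circ: "(x \<cdot> y) \<odot> z = (x \<cdot> z) \<odot> y"
    and dot_circ_compat:
      "scale 2 (z \<cdot> (x \<odot> y)) = (z \<cdot> x) \<odot> y + x \<odot> (z \<cdot> y)"

text \<open>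
  Below, \<open>+\<close> and \<open>\<Sum>\<close> on sets of vectors are the elementwise operations of
  \<^theory>\<open>HOL-Library.Set_Algebras\<close>, that is, sums of subspaces.
\<close>

definition (in module) span_prod :: "('b \<Rightarrow> 'b \<Rightarrow> 'b) \<Rightarrow> 'b set \<Rightarrow> 'b set \<Rightarrow> 'b set"
  where "span_prod mult X Y = span {mult x y | x y. x \<in> X \<and> y \<in> Y}"

context transposed_novikov_poisson
begin

definition both_prod :: "'v set \<Rightarrow> 'v set \<Rightarrow> 'v set"
  where "both_prod X Y = span_prod (\<cdot>) X Y + span_prod (\<odot>) X Y"

definition subalgebra :: "'v set \<Rightarrow> bool"
  where "subalgebra A \<longleftrightarrow> subspace A \<and> both_prod A A \<subseteq> A"

primrec derived :: "'v set \<Rightarrow> nat \<Rightarrow> 'v set" where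
  "derived A 0 = A"
| "derived A (Suc n) = both_prod (derived A n) (derived A n)"

definition solvable :: "'v set \<Rightarrow> bool"
  where "solvable A \<longleftrightarrow> (\<exists>m. derived A m = {0})"

text \<open>
  The lower central series and the right series start at index \<open>1\<close>. Their values at \<open>0\<close> are
  junk and are excluded in the definitions of nilpotency and right nilpotency.
\<close>

fun lower_central :: "'v set \<Rightarrow> nat \<Rightarrow> 'v set" where
  "lower_central A n =
    (if n \<le> 1 then A
     else (\<Sum>i\<in>{1..n-1}. both_prod (lower_central A i) (lower_central A (n - i))))"

declare lower_central.simps [simp del]

definition nilpotent :: "'v set \<Rightarrow> bool"
  where "nilpotent A \<longleftrightarrow> (\<exists>m\<ge>1. lower_central A m = {0})"

fun right_series :: "'v set \<Rightarrow> nat \<Rightarrow> 'v set" where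
  "right_series A n = (if n \<le> 1 then A else both_prod (right_series A (n - 1)) A)"

declare right_series.simps [simp del]

definition right_nilpotent :: "'v set \<Rightarrow> bool"
  where "right_nilpotent A \<longleftrightarrow> (\<exists>n\<ge>1. right_series A n = {0})"

lemma lower_central_2: "lower_central A 2 = both_prod A A"
proof -
  have "lower_central A 1 = A"
    by (simp add: lower_central.simps)
  then show ?thesis
    by (subst lower_central.simps) simp
qed

lemma subspace_both_prod: "subspace (both_prod X Y)"
proof -
  have "A + B = {a + b | a b. a \<in> A \<and> b \<in> B}" for A B :: "'v set"
    by (auto simp: set_plus_def)
  then show ?thesis
    by (simp add: both_prod_def span_prod_def subspace_sums)
qed

lemma subalgebra_UNIV: "subalgebra UNIV"
  by (simp add: subalgebra_def)

lemma both_prod_mono: "X \<subseteq> X' \<Longrightarrow> Y \<subseteq> Y' \<Longrightarrow> both_prod X Y \<subseteq> both_prod X' Y'"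
  unfolding both_prod_def span_prod_def
  by (intro set_plus_mono2 span_mono) auto

lemma subalgebra_square: "subalgebra (lower_central UNIV 2)"
  by (simp add: subalgebra_def lower_central_2 subspace_both_prod both_prod_mono)

end

end

theory Submission
  imports Defs
begin

text \<open>
  In characteristic other than \<open>2\<close> the product \<open>I * J = I \<cdot> J + I \<odot> J\<close> of two ideals is again an
  ideal, so all terms of the derived series and of the right series are ideals. For an ideal \<open>J\<close>,
  both \<open>P\<^sup>2 * J\<close> and \<open>J * P\<^sup>2\<close> lie in \<open>J * P\<close>; hence, by induction on the terms \<open>J\<close> of the right
  series, right nilpotency makes \<open>P\<^sup>2\<close> nilpotent. To get right nilpotency from solvability, it is
  enough to show that if some term of the right series lies in \<open>J\<close>, then a later one lies in
  \<open>J * J\<close>. Long words in right multiplications carry \<open>P * J\<close> into \<open>J * J\<close>, because each letter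
  moves into one of the two factors. Modulo \<open>P * J\<close>, which contains every \<open>z \<cdot> a\<close> with \<open>z \<in> J\<close>, left
  symmetry reads \<open>(z \<odot> a) \<odot> y = z \<odot> (a \<odot> y)\<close>, so a long word applied to \<open>z\<close> becomes a product of
  \<open>z\<close> with an element far down the right series, which lies in \<open>J \<odot> J\<close>.
\<close>

context transposed_novikov_poisson
begin

section \<open>Ideals and their products\<close>

definition ideal :: "'v set \<Rightarrow> bool"
  where "ideal I \<longleftrightarrow> subspace I \<and> (\<forall>x\<in>I. \<forall>y. x \<cdot> y \<in> I \<and> x \<odot> y \<in> I \<and> y \<odot> x \<in> I)"

lemma ideal_subspace: "ideal I \<Longrightarrow> subspace I"
  and ideal_dot_right: "ideal I \<Longrightarrow> x \<in> I \<Longrightarrow> x \<cdot> y \<in> I"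
  and ideal_dot_left: "ideal I \<Longrightarrow> x \<in> I \<Longrightarrow> y \<cdot> x \<in> I"
  and ideal_circ_right: "ideal I \<Longrightarrow> x \<in> I \<Longrightarrow> x \<odot> y \<in> I"
  and ideal_circ_left: "ideal I \<Longrightarrow> x \<in> I \<Longrightarrow> y \<odot> x \<in> I"
  by (auto simp: ideal_def dot_commute[of y])

lemma ideal_UNIV: "ideal UNIV"
  by (simp add: ideal_def)

lemma dot_in_both_prod:
  assumes "x \<in> X" "y \<in> Y"
  shows "x \<cdot> y \<in> both_prod X Y"
proof -
  have "x \<cdot> y \<in> span_prod (\<cdot>) X Y"
    unfolding span_prod_def using assms by (intro span_base) auto
  moreover have "0 \<in> span_prod (\<odot>) X Y"
    by (simp add: span_prod_def span_zero)
  ultimately have "x \<cdot> y + 0 \<in> both_prod X Y"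
    unfolding both_prod_def by (rule set_plus_intro)
  then show ?thesis by simp
qed

lemma circ_in_both_prod:
  assumes "x \<in> X" "y \<in> Y"
  shows "x \<odot> y \<in> both_prod X Y"
proof -
  have "x \<odot> y \<in> span_prod (\<odot>) X Y"
    unfolding span_prod_def using assms by (intro span_base) auto
  moreover have "0 \<in> span_prod (\<cdot>) X Y"
    by (simp add: span_prod_def span_zero)
  ultimately have "0 + x \<odot> y \<in> both_prod X Y"
    unfolding both_prod_def by (intro set_plus_intro)
  then show ?thesis by simp
qed

lemma both_prod_least:
  assumes "subspace S"
    and "\<And>x y. x \<in> X \<Longrightarrow> y \<in> Y \<Longrightarrow> x \<cdot> y \<in> S"
    and "\<And>x y. x \<in> X \<Longrightarrow> y \<in> Y \<Longrightarrow> x \<odot> y \<in> S"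
  shows "both_prod X Y \<subseteq> S"
proof -
  have "span_prod (\<cdot>) X Y \<subseteq> S" "span_prod (\<odot>) X Y \<subseteq> S"
    unfolding span_prod_def by (rule span_minimal; use assms in blast)+
  then show ?thesis
    unfolding both_prod_def using assms(1) by (auto elim!: set_plus_elim intro: subspace_add)
qed

lemma linear_dot_left: "Vector_Spaces.linear scale scale (\<lambda>x. x \<cdot> y)"
  and linear_circ_left: "Vector_Spaces.linear scale scale (\<lambda>x. x \<odot> y)"
  and linear_circ_right: "Vector_Spaces.linear scale scale (\<lambda>y. x \<odot> y)"
  using comm_assoc_algebra_axioms novikov_algebra_axioms
  by (auto simp: comm_assoc_algebra_def novikov_algebra_def
      intro: vector_space_bilinear.linear_left vector_space_bilinear.linear_right)

lemma subspace_linear_vimage: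
  assumes "Vector_Spaces.linear scale scale f" "subspace S"
  shows "subspace {x. f x \<in> S}"
proof -
  interpret f: Vector_Spaces.linear scale scale f by (rule assms)
  show ?thesis
    using f.subspace_vimage[OF assms(2)] by (simp add: vimage_def)
qed

text \<open>The preimage of \<open>S\<close> is a subspace, so generators suffice. With
  \<open>f\<close> a multiplication operator, this reduces closure properties of a product to single
  products of elements.\<close>

lemma both_prod_linear_image:
  assumes "Vector_Spaces.linear scale scale f" "subspace S" "z \<in> both_prod X Y"
    and "\<And>x y. x \<in> X \<Longrightarrow> y \<in> Y \<Longrightarrow> f (x \<cdot> y) \<in> S"
    and "\<And>x y. x \<in> X \<Longrightarrow> y \<in> Y \<Longrightarrow> f (x \<odot> y) \<in> S"
  shows "f z \<in> S"
proof -
  have "both_prod X Y \<subseteq> {x. f x \<in> S}"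
    using assms by (intro both_prod_least subspace_linear_vimage) auto
  then show ?thesis using assms(3) by auto
qed

text \<open>Every use of the characteristic comes down to this division by 2.\<close>

lemma subspace_halve:
  assumes "CHAR('k) \<noteq> 2" "subspace S" "scale 2 x \<in> S"
  shows "x \<in> S"
proof -
  have "(2::'k) \<noteq> 0"
  proof
    assume "(2::'k) = 0"
    then have "of_nat 2 = (0::'k)" by simp
    \<comment> \<open>The divisors of 2 are 1 and 2, and characteristic 1 would force 1 = 0.\<close>
    then have "CHAR('k) dvd 2" by (simp only: of_nat_eq_0_iff_char_dvd)
    then have "CHAR('k) = 1"
      using assms(1) by (metis dvd_imp_le One_nat_def dvd_0_left_iff le_neq_implies_less
          less_2_cases nat.simps(3) numeral_2_eq_2 zero_less_Suc)
    then have "of_nat 1 = (0::'k)" by (metis of_nat_CHAR)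
    then show False by simp
  qed
  then have "x = scale (inverse 2) (scale 2 x)" by simp
  then show ?thesis using subspace_scale[OF assms(2,3)] by metis
qed

lemma circ_circ_left: "x \<odot> (y \<odot> z) = (x \<odot> y) \<odot> z - (y \<odot> x) \<odot> z + y \<odot> (x \<odot> z)"
  using circ_left_symmetric[of x y z] by (simp add: algebra_simps)

lemma circ_dot_left: "x \<odot> (y \<cdot> z) = scale 2 (y \<cdot> (x \<odot> z)) - (y \<cdot> x) \<odot> z"
  using dot_circ_compat[of y x z] by (simp add: algebra_simps)

text \<open>The identities shift an outer factor \<open>y\<close> onto \<open>i\<close> or
  \<open>j\<close>, which stay in their ideals. Only \<open>y \<cdot> (i \<odot> j)\<close> is
  obtained merely up to the factor 2.\<close>

lemma ideal_both_prod:
  assumes char: "CHAR('k) \<noteq> 2" and I: "ideal I" and J: "ideal J"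
  shows "ideal (both_prod I J)"
proof -
  let ?K = "both_prod I J"
  note K = subspace_both_prod[of I J]
  note clos = dot_in_both_prod circ_in_both_prod ideal_dot_right ideal_dot_left
    ideal_circ_right ideal_circ_left I J
  have "z \<cdot> y \<in> ?K" if "z \<in> ?K" for y z
  proof (rule both_prod_linear_image[OF linear_dot_left K that])
    fix i j assume ij: "i \<in> I" "j \<in> J"
    have "i \<cdot> (j \<cdot> y) \<in> ?K" by (intro clos ij)
    then show "i \<cdot> j \<cdot> y \<in> ?K" by (simp add: dot_assoc)
    have "(y \<cdot> i) \<odot> j + i \<odot> (y \<cdot> j) \<in> ?K"
      by (intro subspace_add[OF K]; intro clos ij)
    then have "scale 2 (y \<cdot> (i \<odot> j)) \<in> ?K" by (simp add: dot_circ_compat)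
    then show "i \<odot> j \<cdot> y \<in> ?K"
      using subspace_halve[OF char K] by (simp add: dot_commute)
  qed
  moreover have "z \<odot> y \<in> ?K" if "z \<in> ?K" for y z
  proof (rule both_prod_linear_image[OF linear_circ_left K that])
    fix i j assume ij: "i \<in> I" "j \<in> J"
    have "(i \<cdot> y) \<odot> j \<in> ?K" "(i \<odot> y) \<odot> j \<in> ?K" by (intro clos ij)+
    then show "i \<cdot> j \<odot> y \<in> ?K" "i \<odot> j \<odot> y \<in> ?K"
      by (simp_all add: dot_circ[of i j] circ_right_commute[of i j])
  qed
  moreover have "y \<odot> z \<in> ?K" if "z \<in> ?K" for y z
  proof (rule both_prod_linear_image[OF linear_circ_right K that])
    fix i j assume ij: "i \<in> I" "j \<in> J"
    show "y \<odot> (i \<cdot> j) \<in> ?K"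
      unfolding circ_dot_left[of y i j]
      by (intro subspace_diff[OF K] subspace_scale[OF K]; intro clos ij)
    show "y \<odot> (i \<odot> j) \<in> ?K"
      unfolding circ_circ_left[of y i j]
      by (intro subspace_diff[OF K] subspace_add[OF K]; intro clos ij)
  qed
  ultimately show ?thesis by (auto simp: ideal_def K)
qed

lemma ideal_derived: "CHAR('k) \<noteq> 2 \<Longrightarrow> ideal (derived UNIV n)"
  by (induction n) (auto intro: ideal_both_prod ideal_UNIV)

section \<open>Right series and lower central series\<close>

lemma right_series_1: "right_series A (Suc 0) = A"
  by (subst right_series.simps) simp

lemma right_series_Suc: "n \<ge> 1 \<Longrightarrow> right_series A (Suc n) = both_prod (right_series A n) A"
  by (subst right_series.simps) simp

lemma ideal_right_series:
  assumes "CHAR('k) \<noteq> 2"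
  shows "ideal (right_series UNIV n)"
proof (cases n)
  case 0
  then show ?thesis by (simp add: right_series.simps ideal_UNIV)
next
  case (Suc m)
  have "ideal (right_series UNIV (Suc m))"
    by (induction m) (auto simp: right_series_1 right_series_Suc assms intro: ideal_both_prod ideal_UNIV)
  then show ?thesis by (simp add: Suc)
qed

lemma right_series_antimono:
  assumes "CHAR('k) \<noteq> 2" "m \<le> n" "1 \<le> m"
  shows "right_series UNIV n \<subseteq> right_series UNIV m"
  using assms(2)
proof (induction n rule: dec_induct)
  case (step n)
  have "both_prod (right_series UNIV n) UNIV \<subseteq> right_series UNIV n"
    using ideal_right_series[OF assms(1)]
    by (intro both_prod_least) (auto intro: ideal_subspace ideal_dot_right ideal_circ_right)
  then show ?case using step assms(3) by (simp add: right_series_Suc)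
qed simp

lemma sum_sets_least:
  assumes "finite I" "subspace S" "\<And>i. i \<in> I \<Longrightarrow> F i \<subseteq> S"
  shows "sum F I \<subseteq> S"
  using assms(1,3)
proof (induction I)
  case empty
  then show ?case by (simp add: subspace_0[OF assms(2)])
next
  case (insert i I)
  then show ?case
    by (auto elim!: set_plus_elim intro!: subspace_add[OF assms(2)])
qed

lemma summand_subset_sum_sets:
  assumes "finite I" "i \<in> I" "\<And>j. j \<in> I \<Longrightarrow> subspace (F j)"
  shows "F i \<subseteq> sum F I"
proof
  fix x assume x: "x \<in> F i"
  have zero: "0 \<in> sum F J" if "J \<subseteq> I" for J
    using finite_subset[OF that assms(1)] that
  proof (induction J)
    case (insert j J)
    then have "0 + 0 \<in> F j + sum F J"
      by (intro set_plus_intro subspace_0[OF assms(3)]) auto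
    then show ?case using insert by simp
  qed simp
  have "x + 0 \<in> F i + sum F (I - {i})"
    by (intro set_plus_intro x zero) auto
  then show "x \<in> sum F I"
    using assms by (simp add: sum.remove)
qed

lemma lower_central_1: "lower_central A (Suc 0) = A"
  by (subst lower_central.simps) simp

lemma lower_central_sum:
  "n \<ge> 2 \<Longrightarrow> lower_central A n =
    (\<Sum>i\<in>{1..n-1}. both_prod (lower_central A i) (lower_central A (n - i)))"
  by (subst lower_central.simps) simp

lemma both_prod_lower_central:
  assumes "i \<ge> 1" "j \<ge> 1"
  shows "both_prod (lower_central A i) (lower_central A j) \<subseteq> lower_central A (i + j)"
proof -
  have "both_prod (lower_central A i) (lower_central A (i + j - i))
      \<subseteq> (\<Sum>k\<in>{1..i+j-1}. both_prod (lower_central A k) (lower_central A (i + j - k)))"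
    using assms by (intro summand_subset_sum_sets subspace_both_prod) auto
  then show ?thesis using assms by (simp add: lower_central_sum)
qed

lemma lower_central_subset:
  assumes "subalgebra A"
  shows "lower_central A n \<subseteq> A"
proof (induction n rule: less_induct)
  case (less n)
  show ?case
  proof (cases "n \<le> 1")
    case True
    then show ?thesis by (subst lower_central.simps) simp
  next
    case False
    have "both_prod (lower_central A i) (lower_central A (n - i)) \<subseteq> A" if "i \<in> {1..n-1}" for i
    proof -
      have "both_prod (lower_central A i) (lower_central A (n - i)) \<subseteq> both_prod A A"
        using that False by (intro both_prod_mono less) auto
      then show ?thesis using assms by (auto simp: subalgebra_def)
    qed
    with assms have "(\<Sum>i\<in>{1..n-1}. both_prod (lower_central A i) (lower_central A (n - i))) \<subseteq> A"
      by (intro sum_sets_least) (simp_all add: subalgebra_def)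
    then show ?thesis
      using False by (simp add: lower_central_sum)
  qed
qed

section \<open>Solvability from nilpotency of the square\<close>

text \<open>
  Splitting \<open>k\<close> into two halves gives the inclusion for every \<open>k \<le> 2 ^ n\<close> at once, so that it is
  not necessary to know that the lower central series decreases.
\<close>

lemma derived_subset_lower_central:
  assumes "subalgebra A" "1 \<le> k" "k \<le> 2 ^ n"
  shows "derived A n \<subseteq> lower_central A k"
  using assms(2,3)
proof (induction n arbitrary: k)
  case 0
  then show ?case by (simp add: lower_central_1)
next
  case (Suc n)
  show ?case
  proof (cases "k = 1")
    \<comment> \<open>Index 1 has no splitting into two positive indices; here closure of
      \<open>A\<close> under products is used instead.\<close>
    case True
    have "derived A n \<subseteq> A" using Suc.IH[of 1] by (simp add: lower_central_1)
    then have "derived A (Suc n) \<subseteq> both_prod A A" by (simp add: both_prod_mono)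
    then show ?thesis using assms(1) True by (auto simp: subalgebra_def lower_central_1)
  next
    case False
    define i where "i = k div 2"
    have i: "1 \<le> i" "i \<le> 2 ^ n" "1 \<le> k - i" "k - i \<le> 2 ^ n"
      using Suc.prems False unfolding i_def by auto
    have "derived A (Suc n) \<subseteq> both_prod (lower_central A i) (lower_central A (k - i))"
      using Suc.IH i by (simp add: both_prod_mono)
    also have "\<dots> \<subseteq> lower_central A (i + (k - i))"
      using i by (intro both_prod_lower_central)
    finally show ?thesis using i by simp
  qed
qed

lemma derived_Suc_shift: "derived A (Suc n) = derived (both_prod A A) n"
  by (induction n) auto

lemma subspace_derived: "subspace A \<Longrightarrow> subspace (derived A n)"
  by (cases n) (auto simp: subspace_both_prod)

lemma square_nilpotent_imp_solvable:
  assumes "nilpotent (lower_central UNIV 2)"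
  shows "solvable UNIV"
proof -
  let ?M = "lower_central UNIV 2"
  obtain m where m: "m \<ge> 1" "lower_central ?M m = {0}"
    using assms by (auto simp: nilpotent_def)
  \<comment> \<open>Thus \<open>m\<close> derivation steps of the square already reach below its
    \<open>m\<close>-th lower central term.\<close>
  have "m \<le> 2 ^ m" by (simp add: less_imp_le)
  then have "derived ?M m \<subseteq> {0}"
    using derived_subset_lower_central[OF subalgebra_square m(1)] m(2) by metis
  moreover have "derived ?M m = derived UNIV (Suc m)"
    unfolding derived_Suc_shift lower_central_2 ..
  moreover have "0 \<in> derived UNIV (Suc m)"
    by (intro subspace_0 subspace_derived) simp
  ultimately have "derived UNIV (Suc m) = {0}" by auto
  then show ?thesis unfolding solvable_def by (rule exI)
qed

section \<open>Nilpotency of the square from right nilpotency\<close>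

text \<open>
  One factor from the square suffices to descend in the right series, even from the left, since
  \<open>(x \<cdot> y) \<odot> j = (x \<cdot> j) \<odot> y\<close> and \<open>(x \<odot> y) \<odot> j = (x \<odot> j) \<odot> y\<close>.
\<close>

lemma both_prod_square_ideal:
  assumes "ideal J"
  shows "both_prod (both_prod UNIV UNIV) J \<subseteq> both_prod J UNIV"
proof (rule both_prod_least[OF subspace_both_prod])
  fix v j assume v: "v \<in> both_prod UNIV UNIV" and j: "j \<in> J"
  show "v \<cdot> j \<in> both_prod J UNIV"
    using dot_in_both_prod[OF j, of v UNIV] by (simp add: dot_commute)
  show "v \<odot> j \<in> both_prod J UNIV"
  proof (rule both_prod_linear_image[OF linear_circ_left subspace_both_prod v])
    fix x y
    have "(x \<cdot> j) \<odot> y \<in> both_prod J UNIV" "(x \<odot> j) \<odot> y \<in> both_prod J UNIV"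
      by (intro circ_in_both_prod ideal_dot_left[OF assms] ideal_circ_left[OF assms] j UNIV_I)+
    then show "x \<cdot> y \<odot> j \<in> both_prod J UNIV" "x \<odot> y \<odot> j \<in> both_prod J UNIV"
      by (simp_all add: dot_circ[of x y j] circ_right_commute[of x y j])
  qed
qed

text \<open>If two indices add up to at least \<open>2 ^ Suc n\<close>, one of them is at least
  \<open>2 ^ n\<close>, so one factor lies in \<open>right_series UNIV (Suc n)\<close>. A deep left
  factor descends with any right factor; a deep right factor descends because the left one lies in
  the square.\<close>

lemma lower_central_square_subset:
  assumes "CHAR('k) \<noteq> 2" "i \<ge> 2 ^ n"
  shows "lower_central (lower_central UNIV 2) i \<subseteq> right_series UNIV (Suc n)"
  using assms(2)
proof (induction n arbitrary: i)
  case 0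
  then show ?case by (simp add: right_series_1)
next
  case (Suc n)
  let ?M = "lower_central UNIV 2" and ?J = "right_series UNIV (Suc n)"
  have "(2::nat) ^ 1 \<le> 2 ^ Suc n" by (rule power_increasing) auto
  from order_trans[OF this Suc.prems] have i: "i \<ge> 2" by simp
  have "both_prod (lower_central ?M k) (lower_central ?M (i - k)) \<subseteq> both_prod ?J UNIV"
    if k: "k \<in> {1..i-1}" for k
  proof (cases "k \<ge> 2 ^ n")
    case True
    then show ?thesis by (intro both_prod_mono Suc.IH) auto
  next
    case False
    then have "i - k \<ge> 2 ^ n" using Suc.prems by simp
    then have "both_prod (lower_central ?M k) (lower_central ?M (i - k)) \<subseteq> both_prod ?M ?J"
      by (intro both_prod_mono Suc.IH lower_central_subset subalgebra_square)
    also have "\<dots> \<subseteq> both_prod ?J UNIV"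
      unfolding lower_central_2
      by (rule both_prod_square_ideal[OF ideal_right_series[OF assms(1)]])
    finally show ?thesis .
  qed
  then have "lower_central ?M i \<subseteq> both_prod ?J UNIV"
    unfolding lower_central_sum[OF i] by (intro sum_sets_least subspace_both_prod) auto
  then show ?case by (simp add: right_series_Suc)
qed

lemma zero_in_lower_central:
  assumes "subspace A"
  shows "0 \<in> lower_central A n"
proof (cases "n \<le> 1")
  case True
  then show ?thesis using assms by (subst lower_central.simps) (simp add: subspace_0)
next
  case False
  then have "both_prod (lower_central A 1) (lower_central A (n - 1)) \<subseteq> lower_central A n"
    using both_prod_lower_central[of 1 "n - 1" A] by simp
  then show ?thesis using subspace_0[OF subspace_both_prod] by blast
qed

lemma right_nilpotent_imp_square_nilpotent:
  assumes char: "CHAR('k) \<noteq> 2" and "right_nilpotent UNIV"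
  shows "nilpotent (lower_central UNIV 2)"
proof -
  let ?M = "lower_central UNIV 2"
  obtain n where n: "n \<ge> 1" "right_series UNIV n = {0}"
    using assms(2) by (auto simp: right_nilpotent_def)
  have "lower_central ?M (2 ^ n) \<subseteq> right_series UNIV (Suc n)"
    by (rule lower_central_square_subset[OF char]) simp
  also have "\<dots> \<subseteq> {0}"
    using right_series_antimono[OF char, of n "Suc n"] n by simp
  finally have "lower_central ?M (2 ^ n) = {0}"
    using zero_in_lower_central subalgebra_square by (auto simp: subalgebra_def)
  then show ?thesis
    unfolding nilpotent_def by (intro exI[of _ "2 ^ n"]) simp
qed

section \<open>Right nilpotency from solvability\<close>

text \<open>This is the transporter into \<open>K\<close> of the words of length \<open>n\<close> in
  right multiplications of both kinds; the recursion peels off the letter applied first.\<close>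

primrec absorbed :: "'v set \<Rightarrow> nat \<Rightarrow> 'v set" where
  "absorbed K 0 = K"
| "absorbed K (Suc n) = {z. \<forall>x. z \<cdot> x \<in> absorbed K n \<and> z \<odot> x \<in> absorbed K n}"

lemma subspace_absorbed:
  assumes "subspace K"
  shows "subspace (absorbed K n)"
proof (induction n)
  case (Suc n)
  have "absorbed K (Suc n) =
      \<Inter>(range (\<lambda>x. {z. z \<cdot> x \<in> absorbed K n} \<inter> {z. z \<odot> x \<in> absorbed K n}))"
    by auto
  moreover have "subspace ({z. z \<cdot> x \<in> absorbed K n} \<inter> {z. z \<odot> x \<in> absorbed K n})" for x
    by (intro subspace_inter subspace_linear_vimage linear_dot_left linear_circ_left Suc)
  ultimately show ?case by (auto intro!: subspace_Inter)
qed (simp add: assms)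

lemma absorbed_mono:
  assumes "ideal K" "m \<le> n"
  shows "absorbed K m \<subseteq> absorbed K n"
proof -
  have "absorbed K k \<subseteq> absorbed K (Suc k)" for k
    by (induction k) (use assms(1) in \<open>auto intro: ideal_dot_right ideal_circ_right\<close>)
  then show ?thesis using assms(2) by (rule lift_Suc_mono_le)
qed

lemma ideal_subset_absorbed: "ideal K \<Longrightarrow> K \<subseteq> absorbed K n"
  using absorbed_mono[of K 0 n] by simp

text \<open>Each further term of the right series spends one letter and so lowers the absorption
  index by one.\<close>

lemma right_series_subset_absorbed:
  assumes "subspace K" "m \<ge> 1" "right_series UNIV m \<subseteq> absorbed K n"
  shows "right_series UNIV (m + n) \<subseteq> K"
proof -
  have "k \<le> n \<Longrightarrow> right_series UNIV (m + k) \<subseteq> absorbed K (n - k)" for k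
  proof (induction k)
    case (Suc k)
    then have "right_series UNIV (m + k) \<subseteq> absorbed K (Suc (n - Suc k))"
      by (simp add: Suc_diff_Suc)
    then have "both_prod (right_series UNIV (m + k)) UNIV \<subseteq> absorbed K (n - Suc k)"
      by (intro both_prod_least subspace_absorbed assms(1)) auto
    then show ?case using assms(2) by (simp add: right_series_Suc)
  qed (simp add: assms)
  from this[of n] show ?thesis by simp
qed

context
  fixes J :: "'v set" and m :: nat
  assumes char: "CHAR('k) \<noteq> 2"
    and J: "ideal J"
    and m: "m \<ge> 1" "right_series UNIV m \<subseteq> J"
begin

lemma ideal_square: "ideal (both_prod J J)"
  by (rule ideal_both_prod[OF char J J])

text \<open>No span is taken, so that each element remains a single product whose letters can be
  regrouped by associativity.\<close>

primrec dot_chain :: "nat \<Rightarrow> 'v set" where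
  "dot_chain 0 = J"
| "dot_chain (Suc q) = {j \<cdot> x | j x. j \<in> dot_chain q}"

lemma dot_chain_subset: "dot_chain q \<subseteq> J"
  by (induction q) (use J in \<open>auto intro: ideal_dot_right\<close>)

lemma dot_chain_Suc_factor:
  "j \<in> dot_chain (Suc q) \<Longrightarrow> \<exists>i\<in>J. \<exists>b\<in>right_series UNIV (Suc q). j = i \<cdot> b"
proof (induction q arbitrary: j)
  case 0
  then show ?case by (auto simp: right_series_1)
next
  case (Suc q)
  then obtain j' x where j': "j' \<in> dot_chain (Suc q)" "j = j' \<cdot> x" by auto
  then obtain i b where "i \<in> J" "b \<in> right_series UNIV (Suc q)" "j' = i \<cdot> b"
    using Suc.IH by blast
  then show ?case
    using j' by (auto simp: right_series_Suc dot_assoc intro!: dot_in_both_prod)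
qed

text \<open>The letters gathered into one factor \<open>b\<close> form an element of
  \<open>right_series UNIV q\<close>, hence of \<open>J\<close>, and the other factor is in
  \<open>J\<close> from the start.\<close>

lemma dot_chain_subset_square: "q \<ge> m \<Longrightarrow> dot_chain q \<subseteq> both_prod J J"
proof
  fix j assume q: "q \<ge> m" and "j \<in> dot_chain q"
  moreover obtain r where r: "q = Suc r" using q m by (cases q) auto
  ultimately obtain i b where i: "i \<in> J" "b \<in> right_series UNIV q" "j = i \<cdot> b"
    using dot_chain_Suc_factor by blast
  moreover have "b \<in> J"
    using i right_series_antimono[OF char q m(1)] m(2) by auto
  ultimately show "j \<in> both_prod J J" by (simp add: dot_in_both_prod)
qed

text \<open>Here \<open>p\<close> measures the depth of \<open>a\<close>, \<open>q\<close> counts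
  the letters moved onto \<open>j\<close>, and \<open>n\<close> the letters still to come. A letter
  raises \<open>p\<close> or \<open>q\<close> by one, so \<open>p + q + n\<close> is preserved; only
  \<open>\<cdot>\<close> letters ever move onto \<open>j\<close>. When no letters remain,
  \<open>p \<ge> m\<close> puts \<open>a\<close> in \<open>J\<close>, and otherwise
  \<open>q \<ge> m\<close> puts \<open>j\<close> in \<open>both_prod J J\<close>.\<close>

lemma prod_absorbed:
  assumes "p \<ge> 1" "a \<in> right_series UNIV p" "j \<in> dot_chain q" "p + q + n \<ge> 2 * m"
  shows "a \<cdot> j \<in> absorbed (both_prod J J) n \<and> a \<odot> j \<in> absorbed (both_prod J J) n"
  using assms
proof (induction n arbitrary: p q a j)
  case 0
  have j: "j \<in> J" using dot_chain_subset 0 by blast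
  show ?case
  proof (cases "p \<ge> m")
    case True
    then have "a \<in> J" using 0 right_series_antimono[OF char True m(1)] m(2) by auto
    then show ?thesis using j by (simp add: dot_in_both_prod circ_in_both_prod)
  next
    case False
    then have "j \<in> both_prod J J" using 0 dot_chain_subset_square[of q] by auto
    then show ?thesis
      using ideal_square by (auto intro: ideal_dot_left ideal_circ_left)
  qed
next
  case (Suc n)
  let ?N = "absorbed (both_prod J J) n"
  have N: "subspace ?N"
    by (intro subspace_absorbed subspace_both_prod)
  have a: "a \<cdot> x \<in> right_series UNIV (Suc p)" "a \<odot> x \<in> right_series UNIV (Suc p)" for x
    using Suc.prems by (simp_all add: right_series_Suc dot_in_both_prod circ_in_both_prod)
  have j: "x \<cdot> j \<in> dot_chain (Suc q)" for x
    using Suc.prems by (auto simp: dot_commute[of x])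
  have ax: "a \<cdot> x \<cdot> j \<in> ?N" "(a \<cdot> x) \<odot> j \<in> ?N" "(a \<odot> x) \<odot> j \<in> ?N" for x
    using Suc.IH[of "Suc p" _ j q] a Suc.prems by auto
  have xj: "a \<odot> (x \<cdot> j) \<in> ?N" for x
    using Suc.IH[of p a "x \<cdot> j" "Suc q"] j Suc.prems by auto
  have "a \<cdot> j \<cdot> x \<in> ?N" for x
    using ax(1)[of x] by (simp add: dot_assoc dot_commute[of j])
  moreover have "a \<cdot> j \<odot> x \<in> ?N" "a \<odot> j \<odot> x \<in> ?N" for x
    using ax[of x] by (simp_all add: dot_circ[of a j] circ_right_commute[of a j])
  moreover have "a \<odot> j \<cdot> x \<in> ?N" for x
  proof -
    have "(x \<cdot> a) \<odot> j + a \<odot> (x \<cdot> j) \<in> ?N"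
      using ax(2)[of x] xj by (intro subspace_add[OF N]) (simp_all add: dot_commute[of x a])
    then have "scale 2 (x \<cdot> (a \<odot> j)) \<in> ?N" by (simp add: dot_circ_compat)
    then show ?thesis
      using subspace_halve[OF char N] by (simp add: dot_commute[of _ x])
  qed
  ultimately show ?case by simp
qed

text \<open>An arbitrary \<open>a\<close> starts at depth 1 and \<open>j\<close> starts with no
  letters, so \<open>2 * m\<close> letters are enough.\<close>

lemma ideal_prod_absorbed:
  assumes "j \<in> J"
  shows "a \<cdot> j \<in> absorbed (both_prod J J) (2 * m)" "a \<odot> j \<in> absorbed (both_prod J J) (2 * m)"
  using prod_absorbed[of 1 a j 0 "2 * m"] assms by (simp_all add: right_series_1)

text \<open>This treats the element of \<open>J\<close> on the left. Multiplying by \<open>y\<close>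
  gives \<open>z \<odot> (a \<odot> y)\<close>, whose right factor is one term deeper, plus products
  with a right factor in \<open>J\<close>, which \<open>2 * m\<close> letters absorb. At depth
  \<open>m\<close> the right factor itself lies in \<open>J\<close>.\<close>

lemma circ_absorbed:
  assumes "z \<in> J" "p \<ge> 1" "a \<in> right_series UNIV p" "p + n \<ge> m"
  shows "z \<odot> a \<in> absorbed (both_prod J J) (2 * m + n)"
  using assms(2-)
proof (induction n arbitrary: p a)
  case 0
  then have "a \<in> J" using right_series_antimono[OF char _ m(1), of p] m(2) by auto
  then show ?case
    using ideal_subset_absorbed[OF ideal_square] assms(1) circ_in_both_prod by blast
next
  case (Suc n)
  let ?N = "absorbed (both_prod J J) (2 * m + n)"
  have N: "subspace ?N"
    by (intro subspace_absorbed subspace_both_prod)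
  have sub: "absorbed (both_prod J J) (2 * m) \<subseteq> ?N"
    by (intro absorbed_mono ideal_square) simp
  have "z \<odot> a \<cdot> y \<in> ?N" for y
    using ideal_prod_absorbed(1)[of "z \<odot> a" y] sub ideal_circ_right[OF J assms(1)]
    by (auto simp: dot_commute[of _ y])
  moreover have "z \<odot> a \<odot> y \<in> ?N" for y
  proof -
    have "a \<odot> y \<in> right_series UNIV (Suc p)"
      using Suc.prems by (simp add: right_series_Suc circ_in_both_prod)
    then have "z \<odot> (a \<odot> y) \<in> ?N"
      using Suc.prems by (intro Suc.IH[of "Suc p"]) auto
    moreover have "(a \<odot> y) \<odot> z \<in> ?N" "a \<odot> (z \<odot> y) \<in> ?N"
      using ideal_prod_absorbed(2) ideal_circ_right[OF J assms(1)] assms(1) sub by auto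
    ultimately have "z \<odot> (a \<odot> y) + (a \<odot> y) \<odot> z - a \<odot> (z \<odot> y) \<in> ?N"
      by (intro subspace_diff[OF N] subspace_add[OF N])
    moreover have "z \<odot> a \<odot> y = z \<odot> (a \<odot> y) + (a \<odot> y) \<odot> z - a \<odot> (z \<odot> y)"
      using circ_circ_left[of z a y] circ_right_commute[of a z y] by simp
    ultimately show ?thesis by simp
  qed
  ultimately show ?case by simp
qed

lemma right_series_subset_square:
  "\<exists>n\<ge>1. right_series UNIV n \<subseteq> both_prod J J"
proof -
  \<comment> \<open>One letter turns \<open>z\<close> into a product, \<open>m\<close> letters push
    its right factor into \<open>J\<close>, and \<open>2 * m\<close> letters absorb the error
    terms.\<close>
  let ?n = "Suc (3 * m)"
  have "z \<in> absorbed (both_prod J J) ?n" if z: "z \<in> J" for z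
  proof -
    have "z \<odot> x \<in> absorbed (both_prod J J) (3 * m)" for x
      using circ_absorbed[OF z, of 1 x m] by (simp add: right_series_1)
    moreover have "z \<cdot> x \<in> absorbed (both_prod J J) (3 * m)" for x
      using ideal_prod_absorbed(1)[OF z, of x] absorbed_mono[OF ideal_square, of "2 * m" "3 * m"]
      by (auto simp: dot_commute[of z])
    ultimately show ?thesis by simp
  qed
  then have "right_series UNIV m \<subseteq> absorbed (both_prod J J) ?n"
    using m(2) by blast
  then have "right_series UNIV (m + ?n) \<subseteq> both_prod J J"
    by (rule right_series_subset_absorbed[OF subspace_both_prod m(1)])
  then show ?thesis using m(1) by (intro exI[of _ "m + ?n"]) simp
qed

end

text \<open>The step from \<open>n\<close> to \<open>Suc n\<close> is the descent from
  \<open>J\<close> to \<open>both_prod J J\<close> with \<open>J = derived UNIV n\<close>.\<close>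

lemma right_series_subset_derived:
  assumes "CHAR('k) \<noteq> 2"
  shows "\<exists>m\<ge>1. right_series UNIV m \<subseteq> derived UNIV n"
proof (induction n)
  case (Suc n)
  then show ?case
    using right_series_subset_square[OF assms ideal_derived[OF assms]] by auto
qed auto

lemma solvable_imp_right_nilpotent:
  assumes char: "CHAR('k) \<noteq> 2" and "solvable UNIV"
  shows "right_nilpotent UNIV"
proof -
  obtain n where "derived UNIV n = {0}"
    using assms(2) by (auto simp: solvable_def)
  then obtain m where "m \<ge> 1" "right_series UNIV m \<subseteq> {0}"
    using right_series_subset_derived[OF char] by metis
  moreover have "0 \<in> right_series UNIV m"
    by (intro subspace_0 ideal_subspace ideal_right_series char)
  ultimately show ?thesis by (auto simp: right_nilpotent_def)
qed

end

theorem theorem3p3: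
  fixes scale :: "'k::field \<Rightarrow> 'v::ab_group_add \<Rightarrow> 'v"
    and dot circ :: "'v \<Rightarrow> 'v \<Rightarrow> 'v"
  assumes "transposed_novikov_poisson scale dot circ"
    and "CHAR('k) \<noteq> 2"
  shows "(transposed_novikov_poisson.right_nilpotent scale dot circ UNIV
            \<longleftrightarrow> transposed_novikov_poisson.nilpotent scale dot circ
                  (transposed_novikov_poisson.lower_central scale dot circ UNIV 2))
       \<and> (transposed_novikov_poisson.nilpotent scale dot circ
              (transposed_novikov_poisson.lower_central scale dot circ UNIV 2)
            \<longleftrightarrow> transposed_novikov_poisson.solvable scale dot circ UNIV)"
proof -
  interpret transposed_novikov_poisson scale dot circ by (rule assms(1))
  show ?thesis
    using right_nilpotent_imp_square_nilpotent[OF assms(2)] square_nilpotent_imp_solvable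
      solvable_imp_right_nilpotent[OF assms(2)] by blast
qed

end
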